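(* Let $\Omega,\Omega^*\subset\mathbb{R}$ be bounded domains (bounded open intervals), and let $U=\Omega\cup\Omega^*$. For any positive density functions $f^+\in C(\overline{\Omega})$ and $f^-\in C(\overline{\Omega^*})$ satisfying the normalized balance condition $\int_\Omega f^+\,dx=\int_{\Omega^*}f^-\,dx=1$, with $f:=f^+-f^-$, there exists a global maximizer of the Kantorovich problem $$(\mathscr{P}):\quad \max_u\Big\{K[u]:=\int_U u f\,dx\Big\}$$ subject to the constraints $u\in W_0^{1,\infty}(U)\cap C(\overline U)$, $u=0$ on $\overline{\Omega\cap\Omega^*}$, and $\|u_x\|_{L^\infty(U)}\le1$.
   Context: Subscript $x$ denotes the (weak) derivative in $x$. The functions $f^+$ and $f^-$ are regarded as extended by zero to the rest of $U$, so that $f=f^+-f^-$ is defined on $U$. When $\Omega\cap\Omega^*=\emptyset$, $C(\overline U)$ is understood as $C(\overline\Omega)$ and $C(\overline{\Omega^*})$ respectively: the function is continuous on each of $\overline\Omega$, $\overline{\Omega^*}$ separately, and it vanishes at the endpoints of each interval. *)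

theory Defs
  imports "HOL-Probability.Essential_Supremum"
begin

definition domain_1d :: "real set \<Rightarrow> bool" where
  "domain_1d D \<longleftrightarrow> open D \<and> connected D \<and> D \<noteq> {}"

text \<open>The space \<open>C\<^sub>c\<^sup>\<infinity>(U)\<close>, with elements extended by zero to the whole line.\<close>

definition test_functions :: "real set \<Rightarrow> (real \<Rightarrow> real) set" where
  "test_functions U = {\<phi>. (\<forall>n. (deriv ^^ n) \<phi> differentiable_on UNIV) \<and>
     compact (closure {x. \<phi> x \<noteq> 0}) \<and> closure {x. \<phi> x \<noteq> 0} \<subseteq> U}"

definition locally_integrable :: "real set \<Rightarrow> (real \<Rightarrow> real) \<Rightarrow> bool" where
  "locally_integrable U u \<longleftrightarrow> (\<forall>C. compact C \<and> C \<subseteq> U \<longrightarrow> set_integrable lebesgue C u)"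

text \<open>A weak derivative is only determined almost everywhere, so it is a relation here.\<close>

definition weak_deriv :: "real set \<Rightarrow> (real \<Rightarrow> real) \<Rightarrow> (real \<Rightarrow> real) \<Rightarrow> bool" where
  "weak_deriv U u g \<longleftrightarrow> locally_integrable U u \<and> locally_integrable U g \<and>
     (\<forall>\<phi>\<in>test_functions U.
        (LINT x:U|lebesgue. u x * deriv \<phi> x) = - (LINT x:U|lebesgue. g x * \<phi> x))"

definition Linf_norm :: "real set \<Rightarrow> (real \<Rightarrow> real) \<Rightarrow> ereal" where
  "Linf_norm U u = esssup (lebesgue_on U) (\<lambda>x. ereal \<bar>u x\<bar>)"

definition Linf :: "real set \<Rightarrow> (real \<Rightarrow> real) set" where
  "Linf U = {u. u \<in> borel_measurable (lebesgue_on U) \<and> Linf_norm U u < \<infinity>}"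

definition W1inf :: "real set \<Rightarrow> (real \<Rightarrow> real) set" where
  "W1inf U = {u \<in> Linf U. \<exists>g\<in>Linf U. weak_deriv U u g}"

text \<open>
  The subscript \<open>0\<close> stands for zero boundary values of the continuous representative. It does not
  mean the closure of \<open>C\<^sub>c\<^sup>\<infinity>(U)\<close> in the norm of \<open>W\<^sup>1\<^sup>,\<^sup>\<infinity>(U)\<close>: every function in that closure is
  continuously differentiable.
\<close>

definition W1inf0 :: "real set \<Rightarrow> (real \<Rightarrow> real) set" where
  "W1inf0 U = {u \<in> W1inf U. \<exists>w. continuous_on (closure U) w \<and>
     (AE x in lebesgue_on U. w x = u x) \<and> (\<forall>x\<in>frontier U. w x = 0)}"

text \<open>
  If \<open>D\<close> and \<open>E\<close> are disjoint, then continuity on \<open>closure (D \<union> E)\<close> is continuity on \<open>closure D\<close> and on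
  \<open>closure E\<close> separately, and \<open>frontier (D \<union> E)\<close> consists of the endpoints of both intervals; a
  common endpoint makes no difference because both one-sided values there are zero.
\<close>

definition admissible :: "real set \<Rightarrow> real set \<Rightarrow> (real \<Rightarrow> real) set" where
  "admissible D E = {u. u \<in> W1inf0 (D \<union> E) \<and> continuous_on (closure (D \<union> E)) u \<and>
     (\<forall>x\<in>closure (D \<inter> E). u x = 0) \<and>
     (\<exists>g. weak_deriv (D \<union> E) u g \<and> Linf_norm (D \<union> E) g \<le> 1)}"

definition extend_zero :: "real set \<Rightarrow> (real \<Rightarrow> real) \<Rightarrow> real \<Rightarrow> real" where
  "extend_zero A h x = (if x \<in> A then h x else 0)"

definition kantorovich :: "real set \<Rightarrow> (real \<Rightarrow> real) \<Rightarrow> (real \<Rightarrow> real) \<Rightarrow> real" where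
  "kantorovich U f u = (LINT x:U|lebesgue. u x * f x)"

end

theory Submission
  imports Defs "HOL-Computational_Algebra.Polynomial"
begin

text \<open>
  The maximizer is explicit. An admissible function is 1-Lipschitz on every interval in
  \<open>D \<union> E\<close> and vanishes on the frontier of \<open>D \<union> E\<close> and on the closure of \<open>D \<inter> E\<close>. Hence it vanishes
  outside the two open sets \<open>D - closure E\<close> and \<open>E - closure D\<close>, and inside each of them its absolute
  value is at most the distance to the complement of that set. As \<open>f > 0\<close> on the first set and
  \<open>f < 0\<close> on the second, the distance function of the first minus that of the second maximizes the
  integrand \<open>u f\<close> pointwise.

  That a bound on the weak derivative gives the Lipschitz bound is shown by testing with a smooth
  approximation of the indicator of an interval. Conversely, integration by parts shows that the
  maximizer, which is piecewise affine, has its classical slope as weak derivative.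
\<close>

subsection \<open>Smooth functions on the line\<close>

text \<open>The regularity clause of \<open>test_functions\<close>, isolated so that it can be
  established apart from the support condition.\<close>

definition smooth :: "(real \<Rightarrow> real) \<Rightarrow> bool" where
  "smooth f \<longleftrightarrow> (\<forall>n. (deriv ^^ n) f differentiable_on UNIV)"

text \<open>Avoids formulas for the iterated derivatives.\<close>

lemma smooth_coinduct:
  assumes f: "f \<in> C"
    and C: "\<And>g. g \<in> C \<Longrightarrow> \<exists>g'\<in>C. \<forall>x. (g has_real_derivative g' x) (at x)"
  shows "smooth f"
  unfolding smooth_def
proof
  fix n
  have diff: "deriv g \<in> C \<and> g differentiable_on UNIV" if g: "g \<in> C" for g
  proof -
    obtain g' where g': "g' \<in> C" "\<And>x. (g has_real_derivative g' x) (at x)"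
      using C[OF g] by blast
    then have "deriv g = g'"
      by (auto intro: DERIV_imp_deriv)
    with g' show ?thesis
      by (auto simp: differentiable_on_def real_differentiable_def)
  qed
  have "(deriv ^^ n) f \<in> C"
    by (induction n) (use f diff in auto)
  then show "(deriv ^^ n) f differentiable_on UNIV"
    using diff by blast
qed

lemma smooth_has_deriv:
  assumes "smooth f"
  shows "(f has_real_derivative deriv f x) (at x)"
proof -
  have "f differentiable_on UNIV"
    using assms unfolding smooth_def by (metis funpow_0)
  then have "f differentiable (at x)"
    by (simp add: differentiable_on_def)
  then show ?thesis
    using DERIV_deriv_iff_real_differentiable by blast
qed

lemma smooth_deriv: "smooth f \<Longrightarrow> smooth (deriv f)"
  unfolding smooth_def by (metis comp_apply funpow_Suc_right)

lemma smooth_continuous: "smooth f \<Longrightarrow> continuous_on S f"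
  by (meson DERIV_continuous continuous_at_imp_continuous_on smooth_has_deriv)

lemma smooth_antiderivative:
  assumes "smooth f" and "\<And>x. (F has_real_derivative f x) (at x)"
  shows "smooth F"
proof (rule smooth_coinduct[where C = "insert F {g. smooth g}"])
  fix g assume "g \<in> insert F {g. smooth g}"
  then consider "g = F" | "smooth g" by blast
  then show "\<exists>g'\<in>insert F {g. smooth g}. \<forall>x. (g has_real_derivative g' x) (at x)"
  proof cases
    case 1
    with assms show ?thesis by (intro bexI[of _ f]) auto
  next
    case 2
    then show ?thesis
      by (intro bexI[of _ "deriv g"]) (simp_all add: smooth_deriv smooth_has_deriv)
  qed
qed simp

text \<open>Each differentiation produces one more factor \<open>a\<close>. The free factor
  \<open>c\<close> absorbs it, so that for fixed \<open>a\<close> and \<open>b\<close> the family is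
  closed under differentiation.\<close>

lemma smooth_affine:
  assumes "smooth f"
  shows "smooth (\<lambda>x. c * f (a * x + b))"
proof (rule smooth_coinduct[where C = "{\<lambda>x. c * g (a * x + b) | c g. smooth g}"])
  show "(\<lambda>x. c * f (a * x + b)) \<in> {\<lambda>x. c * g (a * x + b) | c g. smooth g}"
    using assms by blast
next
  fix h assume "h \<in> {\<lambda>x. c * g (a * x + b) | c g. smooth g}"
  then obtain c g where h: "h = (\<lambda>x. c * g (a * x + b))" and g: "smooth g"
    by blast
  have d: "(h has_real_derivative (c * a) * deriv g (a * x + b)) (at x)" for x
  proof -
    have "((\<lambda>x. a * x + b) has_real_derivative a) (at x)"
      by (auto intro!: derivative_eq_intros)
    then have "((\<lambda>x. c * g (a * x + b)) has_real_derivative c * (deriv g (a * x + b) * a)) (at x)"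
      by (intro DERIV_cmult DERIV_chain2[OF smooth_has_deriv[OF g]])
    then show ?thesis unfolding h by (simp add: mult_ac)
  qed
  have m: "(\<lambda>x. (c * a) * deriv g (a * x + b)) \<in> {\<lambda>x. c * g (a * x + b) | c g. smooth g}"
    using smooth_deriv[OF g] by blast
  show "\<exists>h'\<in>{\<lambda>x. c * g (a * x + b) | c g. smooth g}. \<forall>x. (h has_real_derivative h' x) (at x)"
    by (rule bexI, rule allI, rule d, rule m)
qed

lemma smooth_diff:
  assumes "smooth f" "smooth g"
  shows "smooth (\<lambda>x. f x - g x)"
proof (rule smooth_coinduct[where C = "{\<lambda>x. f x - g x | f g. smooth f \<and> smooth g}"])
  fix h assume "h \<in> {\<lambda>x. f x - g x | f g. smooth f \<and> smooth g}"
  then obtain f g where h: "h = (\<lambda>x. f x - g x)" and fg: "smooth f" "smooth g"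
    by blast
  have d: "(h has_real_derivative deriv f x - deriv g x) (at x)" for x
    unfolding h by (intro DERIV_diff smooth_has_deriv fg)
  have m: "(\<lambda>x. deriv f x - deriv g x) \<in> {\<lambda>x. f x - g x | f g. smooth f \<and> smooth g}"
    using smooth_deriv fg by blast
  show "\<exists>h'\<in>{\<lambda>x. f x - g x | f g. smooth f \<and> smooth g}. \<forall>x. (h has_real_derivative h' x) (at x)"
    by (rule bexI, rule allI, rule d, rule m)
qed (use assms in blast)

text \<open>Products of two smooth functions are not visibly closed under differentiation, but their
  finite sums are, by the product rule. This makes the set a suitable invariant for
  \<open>smooth_coinduct\<close>.\<close>

inductive_set smooth_products :: "(real \<Rightarrow> real) set" where
  product: "smooth f \<Longrightarrow> smooth g \<Longrightarrow> (\<lambda>x. f x * g x) \<in> smooth_products"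
| sum: "p \<in> smooth_products \<Longrightarrow> q \<in> smooth_products \<Longrightarrow> (\<lambda>x. p x + q x) \<in> smooth_products"

lemma smooth_mult:
  assumes "smooth f" "smooth g"
  shows "smooth (\<lambda>x. f x * g x)"
proof (rule smooth_coinduct)
  show "(\<lambda>x. f x * g x) \<in> smooth_products"
    using assms by (rule product)
next
  fix h assume "h \<in> smooth_products"
  then show "\<exists>h'\<in>smooth_products. \<forall>x. (h has_real_derivative h' x) (at x)"
  proof induction
    case (product f g)
    have d: "((\<lambda>x. f x * g x) has_real_derivative f x * deriv g x + deriv f x * g x) (at x)" for x
      by (intro DERIV_mult' smooth_has_deriv product)
    have m: "(\<lambda>x. f x * deriv g x + deriv f x * g x) \<in> smooth_products"
      by (intro smooth_products.intros smooth_deriv product)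
    show ?case
      by (rule bexI, rule allI, rule d, rule m)
  next
    case (sum p q)
    then obtain p' q' where "p' \<in> smooth_products" "q' \<in> smooth_products"
      and "\<And>x. (p has_real_derivative p' x) (at x)" "\<And>x. (q has_real_derivative q' x) (at x)"
      by blast
    then show ?case
      by (intro bexI[of _ "\<lambda>x. p' x + q' x"] allI DERIV_add smooth_products.sum)
  qed
qed

section \<open>Flat functions and smooth steps\<close>

text \<open>For \<open>p = 1\<close> this is the classical smooth function that is flat at the
  origin. The polynomial factor makes the family closed under differentiation.\<close>

definition flat :: "real poly \<Rightarrow> real \<Rightarrow> real" where
  "flat p x = (if x > 0 then poly p (1 / x) * exp (- (1 / x)) else 0)"

lemma tendsto_poly_div_exp: "((\<lambda>t. poly p t * exp (- t)) \<longlongrightarrow> (0::real)) at_top"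
proof -
  have "((\<lambda>t. \<Sum>i\<le>degree p. coeff p i * (t ^ i / exp t)) \<longlongrightarrow> (\<Sum>i\<le>degree p. coeff p i * 0)) at_top"
    by (intro tendsto_intros tendsto_power_div_exp_0)
  moreover have "(\<Sum>i\<le>degree p. coeff p i * (t ^ i / exp t)) = poly p t * exp (- t)" for t
    by (simp add: poly_altdef sum_distrib_right exp_minus divide_inverse mult.assoc)
  ultimately show ?thesis by simp
qed

text \<open>With \<open>t = 1 / x\<close>, the chain rule turns \<open>p(t) exp(-t)\<close> into
  \<open>t^2 (p(t) - p'(t)) exp(-t)\<close>, again a member of the family. At the origin,
  exponential decay beats every polynomial.\<close>

lemma flat_has_deriv:
  "(flat p has_real_derivative flat (monom 1 2 * (p - pderiv p)) x) (at x)"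
proof -
  let ?q = "monom 1 2 * (p - pderiv p)"
  consider "x > 0" | "x < 0" | "x = 0" by linarith
  then show ?thesis
  proof cases
    case 1
    have inv: "((\<lambda>x. 1 / x) has_real_derivative - (1 / x\<^sup>2)) (at x)"
      using 1 by (auto intro!: derivative_eq_intros simp: power2_eq_square)
    have "((\<lambda>x. poly p (1 / x) * exp (- (1 / x))) has_real_derivative
        poly (pderiv p) (1 / x) * - (1 / x\<^sup>2) * exp (- (1 / x))
        + exp (- (1 / x)) * - (- (1 / x\<^sup>2)) * poly p (1 / x)) (at x)"
      by (intro DERIV_mult DERIV_chain2[OF poly_DERIV inv] DERIV_chain2[OF DERIV_exp] DERIV_minus inv)
    then have "((\<lambda>x. poly p (1 / x) * exp (- (1 / x))) has_real_derivative flat ?q x) (at x)"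
      using 1 by (simp add: flat_def poly_monom algebra_simps power_divide)
    then show ?thesis
      by (rule has_field_derivative_transform_within_open[where S = "{0<..}"])
         (use 1 in \<open>auto simp: flat_def\<close>)
  next
    case 2
    have "((\<lambda>x. 0) has_real_derivative flat ?q x) (at x)"
      using 2 by (simp add: flat_def)
    then show ?thesis
      by (rule has_field_derivative_transform_within_open[where S = "{..<0}"])
         (use 2 in \<open>auto simp: flat_def\<close>)
  next
    case 3
    \<comment> \<open>The right difference quotient at 0 is \<open>t p(t) exp(-t)\<close> with
      \<open>t = 1 / h\<close>, and \<open>pCons 0 p\<close> is the polynomial
      \<open>t p(t)\<close>.\<close>
    have "((\<lambda>h. poly (pCons 0 p) (inverse h) * exp (- (inverse h))) \<longlongrightarrow> 0) (at_right 0)"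
      by (rule filterlim_compose[OF tendsto_poly_div_exp filterlim_inverse_at_top_right])
    then have "((\<lambda>h. (flat p h - flat p 0) / h) \<longlongrightarrow> 0) (at_right 0)"
      by (rule Lim_transform_eventually)
         (auto simp: flat_def eventually_at_filter field_simps)
    moreover have "((\<lambda>h. (flat p h - flat p 0) / h) \<longlongrightarrow> 0) (at_left 0)"
      by (rule Lim_transform_eventually[OF tendsto_const])
         (auto simp: flat_def eventually_at_filter)
    ultimately have "((\<lambda>h. (flat p h - flat p 0) / h) \<longlongrightarrow> 0) (at 0)"
      by (simp add: filterlim_split_at)
    then show ?thesis
      using 3 by (simp add: has_field_derivative_iff flat_def)
  qed
qed

lemma smooth_flat: "smooth (flat p)"
proof (rule smooth_coinduct[where C = "range flat"])
  fix g assume "g \<in> range flat"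
  then show "\<exists>g'\<in>range flat. \<forall>x. (g has_real_derivative g' x) (at x)"
    using flat_has_deriv by (metis rangeE rangeI)
qed simp

text \<open>The step is the normalized antiderivative of a smooth bump \<open>b\<close> that is
  positive exactly on \<open>(-r, r)\<close>.\<close>

lemma smooth_step_exists:
  fixes r :: real
  assumes "r > 0"
  obtains H where "smooth H" "\<And>t. 0 \<le> deriv H t" "\<And>t. t \<le> - r \<Longrightarrow> H t = 0" "\<And>t. t \<ge> r \<Longrightarrow> H t = 1"
proof -
  define b where "b t = flat 1 (t + r) * flat 1 (r - t)" for t
  have b: "smooth b"
    using smooth_mult[OF smooth_affine[where c = 1 and a = 1 and b = r, OF smooth_flat[of 1]]
        smooth_affine[where c = 1 and a = "- 1" and b = r, OF smooth_flat[of 1]]]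
    by (simp add: b_def[abs_def])
  have b_nonneg: "0 \<le> b t" for t
    by (simp add: b_def flat_def)
  have b_pos: "0 < b t" if "- r < t" "t < r" for t
    using that by (simp add: b_def flat_def)
  have b_zero: "b t = 0" if "t \<le> - r \<or> r \<le> t" for t
    using that by (auto simp: b_def flat_def)
  have "isCont b t" for t
    using smooth_continuous[OF b, of UNIV] by (simp add: continuous_on_eq_continuous_at)
  then obtain J where "\<And>t. (J has_vector_derivative b t) (at t)"
    using einterval_antiderivative[of "-\<infinity>" \<infinity> b] by auto
  then have J: "(J has_real_derivative b t) (at t)" for t
    by (simp add: has_real_derivative_iff_has_vector_derivative)
  \<comment> \<open>Strict growth makes the normalizing constant \<open>J r - J (- r)\<close>
    positive.\<close>
  have "J (- r) < J r"
  proof (rule DERIV_pos_imp_increasing_open[of "- r" r J])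
    show "- r < r" using \<open>r > 0\<close> by simp
    show "\<exists>y. (J has_real_derivative y) (at t) \<and> y > 0" if "- r < t" "t < r" for t
      using J b_pos that by blast
    show "continuous_on {- r..r} J"
      by (intro continuous_at_imp_continuous_on ballI DERIV_isCont[OF J])
  qed
  then have k: "J r - J (- r) > 0" by simp
  have const: "J y = J x" if "x \<le> y" and zero: "\<And>t. x < t \<Longrightarrow> t < y \<Longrightarrow> b t = 0" for x y
  proof (cases "x = y")
    case False
    show ?thesis
    proof (rule DERIV_isconst_end[of x y J])
      show "x < y" using that(1) False by simp
      show "continuous_on {x..y} J"
        by (intro continuous_at_imp_continuous_on ballI DERIV_isCont[OF J])
      show "(J has_real_derivative 0) (at t)" if "x < t" "t < y" for t
        using J[of t] zero[OF that] by simp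
    qed
  qed simp
  have left: "J t = J (- r)" if "t \<le> - r" for t
    using const[OF that] b_zero by simp
  have right: "J t = J r" if "t \<ge> r" for t
    using const[OF that] b_zero by simp
  define H where "H t = (J t - J (- r)) / (J r - J (- r))" for t
  have H: "(H has_real_derivative b t / (J r - J (- r))) (at t)" for t
    using DERIV_cdivide[OF DERIV_diff[OF J DERIV_const]] unfolding H_def by simp
  have "smooth (\<lambda>t. b t / (J r - J (- r)))"
    using smooth_affine[OF b, of "inverse (J r - J (- r))" 1 0] by (simp add: divide_inverse mult.commute)
  then have "smooth H"
    by (rule smooth_antiderivative) (rule H)
  moreover have "0 \<le> deriv H t" for t
    using DERIV_imp_deriv[OF H] b_nonneg k by simp
  moreover have "H t = 0" if "t \<le> - r" for t
    using left[OF that] by (simp add: H_def)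
  moreover have "H t = 1" if "t \<ge> r" for t
    using right[OF that] k by (auto simp: H_def)
  ultimately show ?thesis by (rule that)
qed

subsection \<open>Weak derivatives\<close>

lemma set_integral_reduce:
  assumes "B \<subseteq> A" "\<And>t. t \<in> A - B \<Longrightarrow> f t = 0"
  shows "(LINT t:A|M. f t) = (LINT t:B|M. f t)"
proof -
  have "indicator A t *\<^sub>R f t = indicator B t *\<^sub>R f t" for t
    using assms by (cases "t \<in> B"; cases "t \<in> A") auto
  then show ?thesis
    by (simp only: set_lebesgue_integral_def)
qed

lemma set_integrable_continuous_compact:
  fixes u :: "real \<Rightarrow> real"
  assumes "compact C" "continuous_on C u"
  shows "set_integrable lebesgue C u"
proof -
  have "integrable lborel (\<lambda>x. indicator C x *\<^sub>R u x)"
    by (rule borel_integrable_compact[OF assms])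
  then show ?thesis
    unfolding set_integrable_def
    by (subst integrable_completion) auto
qed

lemma set_integrable_bounded_compact:
  fixes g :: "real \<Rightarrow> real"
  assumes "compact C" "g \<in> borel_measurable (lebesgue_on C)" "\<And>x. x \<in> C \<Longrightarrow> \<bar>g x\<bar> \<le> L"
  shows "set_integrable lebesgue C g"
proof (rule measurable_bounded_by_integrable_imp_absolutely_integrable)
  show "(\<lambda>x. L) integrable_on C"
    by (intro set_lebesgue_integral_eq_integral set_integrable_continuous_compact assms continuous_intros)
  show "C \<in> sets lebesgue"
    using assms(1) by (simp add: borel_compact)
qed (use assms in auto)

lemma test_functions_smooth: "\<phi> \<in> test_functions U \<Longrightarrow> smooth \<phi>"
  by (simp add: test_functions_def smooth_def)

lemma deriv_zero_off_support:
  assumes "t \<notin> closure {x. \<phi> x \<noteq> 0}"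
  shows "deriv \<phi> t = (0::real)"
proof -
  have "(\<phi> has_real_derivative 0) (at t)"
    by (rule has_field_derivative_transform_within_open[of "\<lambda>_. 0" _ _ "- closure {x. \<phi> x \<noteq> 0}"])
       (use assms closure_subset[of "{x. \<phi> x \<noteq> 0}"] in auto)
  then show ?thesis
    by (rule DERIV_imp_deriv)
qed

text \<open>The product of \<open>u\<close> and a test function is continuous and differentiable off
  \<open>S\<close>, so the fundamental theorem of calculus with finitely many exceptions gives
  integration by parts; the boundary terms vanish.\<close>

lemma weak_deriv_piecewise:
  fixes u g :: "real \<Rightarrow> real"
  assumes u: "continuous_on UNIV u" and S: "finite S"
    and deriv: "\<And>x. x \<notin> S \<Longrightarrow> (u has_real_derivative g x) (at x)"
    and g: "g \<in> borel_measurable lebesgue" "\<And>x. \<bar>g x\<bar> \<le> L"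
  shows "weak_deriv U u g"
  unfolding weak_deriv_def
proof (intro conjI ballI)
  have g_on: "g \<in> borel_measurable (lebesgue_on C)" for C
    by (rule measurable_restrict_space1[OF g(1)])
  show "locally_integrable U u"
    unfolding locally_integrable_def
    using u by (auto intro!: set_integrable_continuous_compact continuous_on_subset[OF u])
  show "locally_integrable U g"
    unfolding locally_integrable_def
    using g_on g(2) by (auto intro!: set_integrable_bounded_compact)
  fix \<phi> assume \<phi>: "\<phi> \<in> test_functions U"
  define K where "K = closure {x. \<phi> x \<noteq> 0}"
  have K: "compact K" "K \<subseteq> U"
    using \<phi> by (auto simp: K_def test_functions_def)
  have off: "\<phi> t = 0" "deriv \<phi> t = 0" if "t \<notin> K" for t
    using that closure_subset[of "{x. \<phi> x \<noteq> 0}"] deriv_zero_off_support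
    by (auto simp: K_def)
  obtain B where B: "B > 0" "\<And>t. t \<in> K \<Longrightarrow> \<bar>t\<bar> \<le> B"
    using compact_imp_bounded[OF K(1)] unfolding bounded_pos by auto
  \<comment> \<open>The margin 1 puts both endpoints outside the support. \<open>I\<close> may leave
    \<open>U\<close>, which is why \<open>u\<close> is taken continuous on the whole line.\<close>
  define I where "I = {- (B + 1)..B + 1}"
  have KI: "K \<subseteq> I"
    unfolding I_def by (auto dest!: B(2))
  note smooth = test_functions_smooth[OF \<phi>]
  have int1: "set_integrable lebesgue I (\<lambda>t. u t * deriv \<phi> t)"
    unfolding I_def
    by (intro absolutely_integrable_continuous_real continuous_intros
        continuous_on_subset[OF u] smooth_continuous smooth_deriv smooth) auto
  have "bounded (\<phi> ` I)"
    unfolding I_def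
    by (intro compact_imp_bounded compact_continuous_image smooth_continuous smooth compact_Icc)
  then obtain P where P: "\<And>t. t \<in> I \<Longrightarrow> \<bar>\<phi> t\<bar> \<le> P"
    unfolding bounded_iff by auto
  have int2: "set_integrable lebesgue I (\<lambda>t. g t * \<phi> t)"
  proof (rule set_integrable_bounded_compact)
    show "compact I" by (simp add: I_def)
    show "(\<lambda>t. g t * \<phi> t) \<in> borel_measurable (lebesgue_on I)"
      by (intro borel_measurable_times g_on continuous_imp_measurable_on_sets_lebesgue
          smooth_continuous smooth) (simp add: I_def)
    show "\<bar>g t * \<phi> t\<bar> \<le> L * P" if "t \<in> I" for t
      unfolding abs_mult using g(2)[of t] P[OF that] by (intro mult_mono) auto
  qed
  have "((\<lambda>t. u t * deriv \<phi> t + g t * \<phi> t) has_integral u (B + 1) * \<phi> (B + 1) - u (- (B + 1)) * \<phi> (- (B + 1))) I"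
    unfolding I_def
  proof (rule fundamental_theorem_of_calculus_strong[OF S])
    fix t assume "t \<in> {- (B + 1)..B + 1} - S"
    then have "((\<lambda>t. u t * \<phi> t) has_real_derivative u t * deriv \<phi> t + g t * \<phi> t) (at t)"
      by (intro DERIV_mult' deriv smooth_has_deriv smooth) auto
    then show "((\<lambda>t. u t * \<phi> t) has_vector_derivative u t * deriv \<phi> t + g t * \<phi> t) (at t)"
      by (simp add: has_real_derivative_iff_has_vector_derivative)
  next
    show "continuous_on {- (B + 1)..B + 1} (\<lambda>t. u t * \<phi> t)"
      by (intro continuous_intros continuous_on_subset[OF u] smooth_continuous smooth) auto
  qed (use B in auto)
  moreover have "\<phi> (B + 1) = 0" "\<phi> (- (B + 1)) = 0"
    using B(1) by (auto intro!: off dest!: B(2))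
  ultimately have "((\<lambda>t. u t * deriv \<phi> t + g t * \<phi> t) has_integral 0) I"
    by simp
  \<comment> \<open>The fundamental theorem yields a gauge integral of the sum. Absolute
    integrability of each summand identifies it with the sum of two Lebesgue integrals.\<close>
  moreover have "((\<lambda>t. u t * deriv \<phi> t + g t * \<phi> t) has_integral
      (LINT t:I|lebesgue. u t * deriv \<phi> t) + (LINT t:I|lebesgue. g t * \<phi> t)) I"
    by (intro has_integral_add has_integral_set_lebesgue int1 int2)
  ultimately have "(LINT t:I|lebesgue. u t * deriv \<phi> t) + (LINT t:I|lebesgue. g t * \<phi> t) = 0"
    by (metis has_integral_unique)
  \<comment> \<open>Neither of \<open>U\<close> and \<open>I\<close> need contain the other, so the
    comparison passes through \<open>K\<close>.\<close>
  moreover have "(LINT t:U|lebesgue. h t) = (LINT t:I|lebesgue. h t)"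
    if "\<And>t. t \<notin> K \<Longrightarrow> h t = 0" for h :: "real \<Rightarrow> real"
    using set_integral_reduce[OF K(2), of h] set_integral_reduce[OF KI, of h] that by auto
  ultimately show "(LINT t:U|lebesgue. u t * deriv \<phi> t) = - (LINT t:U|lebesgue. g t * \<phi> t)"
    using off by auto
qed

text \<open>
  The derivative of a smooth step is a mollifier, so that for \<open>x \<le> y\<close> the difference of the steps
  at \<open>x\<close> and \<open>y\<close> is a test function that approximates the indicator of \<open>[x, y]\<close> and turns the
  definition of the weak derivative into an approximate difference \<open>v y - v x\<close>.
\<close>

lemma step_average:
  fixes v :: "real \<Rightarrow> real"
  assumes H: "smooth H" "\<And>t. 0 \<le> deriv H t" "\<And>t. t \<le> - r \<Longrightarrow> H t = 0" "\<And>t. t \<ge> r \<Longrightarrow> H t = 1"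
    and r: "r > 0" and v: "continuous_on {z - r..z + r} v"
    and close: "\<And>t. t \<in> {z - r..z + r} \<Longrightarrow> \<bar>v t - v z\<bar> \<le> e"
  shows "\<bar>(LINT t:{z - r..z + r}|lebesgue. v t * deriv H (t - z)) - v z\<bar> \<le> e"
proof -
  let ?I = "{z - r..z + r}"
  have cont: "continuous_on ?I (\<lambda>t. deriv H (t - z))"
    by (intro continuous_on_compose2[OF smooth_continuous[OF smooth_deriv[OF H(1)], of UNIV]] continuous_intros) auto
  have int: "set_integrable lebesgue ?I (\<lambda>t. v t * deriv H (t - z))"
    by (intro absolutely_integrable_continuous_real continuous_intros v cont)
  have "((\<lambda>t. deriv H (t - z)) has_integral H (z + r - z) - H (z - r - z)) ?I"
  proof (rule fundamental_theorem_of_calculus)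
    fix t assume "t \<in> ?I"
    have "((\<lambda>t. H (t - z)) has_real_derivative deriv H (t - z) * 1) (at t within ?I)"
      by (intro DERIV_chain2[OF smooth_has_deriv[OF H(1)]]) (auto intro!: derivative_eq_intros)
    then show "((\<lambda>t. H (t - z)) has_vector_derivative deriv H (t - z)) (at t within ?I)"
      by (simp add: has_real_derivative_iff_has_vector_derivative)
  qed (use r in auto)
  then have one: "((\<lambda>t. deriv H (t - z)) has_integral 1) ?I"
    using H(3)[of "- r"] H(4)[of r] by simp
  have "((\<lambda>t. v t * deriv H (t - z) - v z * deriv H (t - z)) has_integral
      (LINT t:?I|lebesgue. v t * deriv H (t - z)) - v z * 1) ?I"
    by (intro has_integral_diff has_integral_set_lebesgue int has_integral_mult_right one)
  then have diff: "((\<lambda>t. (v t - v z) * deriv H (t - z)) has_integral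
      (LINT t:?I|lebesgue. v t * deriv H (t - z)) - v z) ?I"
    by (simp add: algebra_simps)
  \<comment> \<open>The kernel is nonnegative with total mass one, so averaging the bound
    \<open>e\<close> against it gives \<open>e\<close> again.\<close>
  have "norm (integral ?I (\<lambda>t. (v t - v z) * deriv H (t - z))) \<le> integral ?I (\<lambda>t. e * deriv H (t - z))"
  proof (rule integral_norm_bound_integral)
    show "(\<lambda>t. (v t - v z) * deriv H (t - z)) integrable_on ?I"
      using diff by blast
    show "(\<lambda>t. e * deriv H (t - z)) integrable_on ?I"
      using has_integral_mult_right[OF one] by blast
    show "norm ((v t - v z) * deriv H (t - z)) \<le> e * deriv H (t - z)" if "t \<in> ?I" for t
      using close[OF that] H(2)[of "t - z"] by (simp add: abs_mult mult_right_mono)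
  qed
  then show ?thesis
    using integral_unique[OF diff] integral_unique[OF one] by simp
qed

text \<open>The error \<open>e\<close> splits into thirds: one for replacing \<open>v\<close> by an
  average at each endpoint, and one for the excess length \<open>2 * r\<close> of the support of the
  test function.\<close>

lemma weak_deriv_bounded_imp_lipschitz:
  assumes U: "open U" and weak: "weak_deriv U v g" and L: "Linf_norm U g \<le> ereal L"
    and v: "continuous_on U v" and xy: "x \<le> y" "{x..y} \<subseteq> U"
  shows "\<bar>v y - v x\<bar> \<le> L * (y - x)"
proof (rule field_le_epsilon)
  fix e :: real assume "e > 0"
  have near: "\<exists>d>0. \<forall>t. \<bar>t - z\<bar> \<le> d \<longrightarrow> t \<in> U \<and> \<bar>v t - v z\<bar> \<le> e / 3" if z: "z \<in> U" for z
  proof -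
    have "isCont v z"
      using v U z continuous_on_eq_continuous_at by blast
    then have "\<forall>\<^sub>F t in nhds z. dist (v t) (v z) < e / 3"
      using \<open>e > 0\<close> by (metis isCont_def tendsto_at_iff_tendsto_nhds tendstoD divide_pos_pos zero_less_numeral)
    moreover have "\<forall>\<^sub>F t in nhds z. t \<in> U"
      using U z by (rule eventually_nhds_in_open)
    ultimately have "\<forall>\<^sub>F t in nhds z. t \<in> U \<and> dist (v t) (v z) < e / 3"
      by eventually_elim simp
    then obtain d where d: "d > 0" "\<And>t. dist t z < d \<Longrightarrow> t \<in> U \<and> dist (v t) (v z) < e / 3"
      unfolding eventually_nhds_metric by blast
    have "t \<in> U \<and> \<bar>v t - v z\<bar> \<le> e / 3" if "\<bar>t - z\<bar> \<le> d / 2" for t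
      using d(2)[of t] that d(1) by (auto simp: dist_real_def)
    then show ?thesis
      using d(1) half_gt_zero by blast
  qed
  have "x \<in> U" "y \<in> U"
    using xy by auto
  then obtain d1 d2 where d1: "d1 > 0" "\<And>t. \<bar>t - x\<bar> \<le> d1 \<Longrightarrow> t \<in> U \<and> \<bar>v t - v x\<bar> \<le> e / 3"
    and d2: "d2 > 0" "\<And>t. \<bar>t - y\<bar> \<le> d2 \<Longrightarrow> t \<in> U \<and> \<bar>v t - v y\<bar> \<le> e / 3"
    using near by meson
  \<comment> \<open>The first two bounds keep the averaging windows in \<open>U\<close> and the
    oscillation of \<open>v\<close> there below \<open>e / 3\<close>. The third gives
    \<open>2 * L * r \<le> e / 3\<close>; adding 1 avoids a zero denominator.\<close>
  define r where "r = min (min d1 d2) (e / (6 * (\<bar>L\<bar> + 1)))"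
  have r: "r > 0" "r \<le> d1" "r \<le> d2" "r \<le> e / (6 * (\<bar>L\<bar> + 1))"
    using d1 d2 \<open>e > 0\<close> by (auto simp: r_def)
  have "L * r \<le> (\<bar>L\<bar> + 1) * r"
    using r(1) by (intro mult_right_mono) auto
  also have "\<dots> \<le> e / 6"
    using r(4) by (simp add: field_simps)
  finally have Lr: "L * r \<le> e / 6" .
  obtain H where H: "smooth H" "\<And>t. 0 \<le> deriv H t" "\<And>t. t \<le> - r \<Longrightarrow> H t = 0" "\<And>t. t \<ge> r \<Longrightarrow> H t = 1"
    using smooth_step_exists[OF r(1)] by blast
  have mono: "H s \<le> H t" if "s \<le> t" for s t
    using DERIV_nonneg_imp_nondecreasing[OF that] smooth_has_deriv[OF H(1)] H(2) by blast
  have H01: "0 \<le> H t" "H t \<le> 1" for t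
    using mono[of "min t (- r)" t] mono[of t "max t r"] H(3)[of "min t (- r)"] H(4)[of "max t r"] by auto
  have H'0: "deriv H t = 0" if "\<bar>t\<bar> > r" for t
  proof -
    have "(H has_real_derivative 0) (at t)" if "t > r"
      by (rule has_field_derivative_transform_within_open[of "\<lambda>_. 1" _ _ "{r<..}"])
         (use that H(4) in auto)
    moreover have "(H has_real_derivative 0) (at t)" if "t < - r"
      by (rule has_field_derivative_transform_within_open[of "\<lambda>_. 0" _ _ "{..<- r}"])
         (use that H(3) in auto)
    ultimately show ?thesis
      using that DERIV_imp_deriv by fastforce
  qed
  define \<phi> where "\<phi> t = H (t - x) - H (t - y)" for t
  define K where "K = {x - r..y + r}"
  have smooth: "smooth \<phi>"
    using smooth_diff[OF smooth_affine[OF H(1), of 1 1 "- x"] smooth_affine[OF H(1), of 1 1 "- y"]]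
    by (simp add: \<phi>_def[abs_def])
  have \<phi>_deriv: "deriv \<phi> t = deriv H (t - x) - deriv H (t - y)" for t
  proof -
    have "((\<lambda>t. H (t - c)) has_real_derivative deriv H (t - c)) (at t)" for c
      using smooth_has_deriv[OF H(1), of "t - c"] DERIV_shift[of H "deriv H (t - c)" t "- c"] by simp
    then have "(\<phi> has_real_derivative deriv H (t - x) - deriv H (t - y)) (at t)"
      unfolding \<phi>_def by (intro DERIV_diff)
    then show ?thesis by (rule DERIV_imp_deriv)
  qed
  have \<phi>01: "0 \<le> \<phi> t" "\<phi> t \<le> 1" for t
    using mono[of "t - y" "t - x"] xy(1) H01[of "t - x"] H01[of "t - y"] by (auto simp: \<phi>_def)
  have \<phi>0: "\<phi> t = 0" if "t \<notin> K" for t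
    using that H(3)[of "t - x"] H(3)[of "t - y"] H(4)[of "t - x"] H(4)[of "t - y"] xy(1)
    by (auto simp: \<phi>_def K_def)
  have KU: "K \<subseteq> U"
  proof
    fix t assume "t \<in> K"
    then have "\<bar>t - x\<bar> \<le> d1 \<or> \<bar>t - y\<bar> \<le> d2 \<or> t \<in> {x..y}"
      using r by (auto simp: K_def)
    then show "t \<in> U"
      using d1(2) d2(2) xy(2) by blast
  qed
  have "closure {t. \<phi> t \<noteq> 0} \<subseteq> K"
    by (rule closure_minimal) (use \<phi>0 in blast, simp add: K_def)
  then have "bounded {t. \<phi> t \<noteq> 0}" "closure {t. \<phi> t \<noteq> 0} \<subseteq> U"
    using KU closure_subset[of "{t. \<phi> t \<noteq> 0}"] bounded_subset[of K "{t. \<phi> t \<noteq> 0}"]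
    by (simp_all add: K_def)
  then have test: "\<phi> \<in> test_functions U"
    using smooth by (simp add: test_functions_def smooth_def compact_closure)
  define A where "A z = (LINT t:{z - r..z + r}|lebesgue. v t * deriv H (t - z))" for z
  have avg: "\<bar>A z - v z\<bar> \<le> e / 3"
    if z: "\<And>t. \<bar>t - z\<bar> \<le> r \<Longrightarrow> t \<in> U \<and> \<bar>v t - v z\<bar> \<le> e / 3" for z
    unfolding A_def
  proof (rule step_average[OF H r(1)])
    show "continuous_on {z - r..z + r} v"
      using z by (intro continuous_on_subset[OF v]) (auto simp: abs_le_iff)
    show "\<bar>v t - v z\<bar> \<le> e / 3" if "t \<in> {z - r..z + r}" for t
      using z[of t] that by (auto simp: abs_le_iff)
  qed
  \<comment> \<open>Both windows lie in \<open>K\<close>, and each kernel vanishes outside its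
    window, so the two averages can be subtracted as integrals over the common set
    \<open>K\<close>.\<close>
  have red: "(LINT t:K|lebesgue. v t * deriv H (t - z)) = A z"
    "set_integrable lebesgue K (\<lambda>t. v t * deriv H (t - z))" if "z = x \<or> z = y" for z
  proof -
    have "{z - r..z + r} \<subseteq> K"
      using that xy(1) by (auto simp: K_def)
    then show "(LINT t:K|lebesgue. v t * deriv H (t - z)) = A z"
      unfolding A_def
      by (rule set_integral_reduce) (use H'0 in \<open>auto simp: abs_if\<close>)
    show "set_integrable lebesgue K (\<lambda>t. v t * deriv H (t - z))"
      unfolding K_def
      by (intro absolutely_integrable_continuous_real continuous_intros
          continuous_on_subset[OF v KU[unfolded K_def]]
          continuous_on_compose2[OF smooth_continuous[OF smooth_deriv[OF H(1)], of UNIV]]) auto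
  qed
  have "(LINT t:U|lebesgue. v t * deriv \<phi> t) = (LINT t:K|lebesgue. v t * deriv \<phi> t)"
    by (rule set_integral_reduce[OF KU]) (use H'0 xy(1) in \<open>auto simp: \<phi>_deriv K_def\<close>)
  also have "\<dots> = A x - A y"
    using set_integral_diff(2)[OF red(2)[of x] red(2)[of y]] red(1)[of x] red(1)[of y]
    by (simp add: \<phi>_deriv right_diff_distrib)
  finally have left: "(LINT t:U|lebesgue. v t * deriv \<phi> t) = A x - A y" .
  have "AE t in lebesgue_on U. ereal \<bar>g t\<bar> \<le> esssup (lebesgue_on U) (\<lambda>t. ereal \<bar>g t\<bar>)"
    by (rule esssup_AE)
  then have "AE t in lebesgue_on U. \<bar>g t\<bar> \<le> L"
    by eventually_elim (use L in \<open>metis Linf_norm_def ereal_less_eq(3) order_trans\<close>)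
  then have AE: "AE t in lebesgue. t \<in> U \<longrightarrow> \<bar>g t\<bar> \<le> L"
    using U by (subst (asm) AE_restrict_space_iff) auto
  have "\<bar>LINT t:U|lebesgue. g t * \<phi> t\<bar> = \<bar>LINT t:K|lebesgue. g t * \<phi> t\<bar>"
    by (subst set_integral_reduce[OF KU]) (use \<phi>0 in auto)
  also have "\<dots> \<le> (LINT t|lebesgue. norm (indicator K t *\<^sub>R (g t * \<phi> t)))"
    unfolding set_lebesgue_integral_def real_norm_def[symmetric] by (rule integral_norm_bound)
  also have "\<dots> \<le> (LINT t|lebesgue. indicator K t *\<^sub>R L)"
  proof (rule integral_mono_AE')
    show "integrable lebesgue (\<lambda>t. indicator K t *\<^sub>R L)"
      using absolutely_integrable_continuous_real[of "x - r" "y + r" "\<lambda>_. L"]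
      by (simp add: set_integrable_def K_def)
    show "AE t in lebesgue. norm (indicator K t *\<^sub>R (g t * \<phi> t)) \<le> indicator K t *\<^sub>R L"
      using AE
    proof eventually_elim
      case (elim t)
      have "\<bar>g t * \<phi> t\<bar> \<le> L" if "t \<in> K"
        using elim that KU \<phi>01[of t] mult_mono[of "\<bar>g t\<bar>" L "\<phi> t" 1] by (auto simp: abs_mult)
      then show ?case by (auto simp: indicator_def)
    qed
    \<comment> \<open>On \<open>K\<close> the sign of \<open>L\<close> is read off from the almost
      everywhere bound on the absolute value of \<open>g\<close>.\<close>
    show "AE t in lebesgue. 0 \<le> indicator K t *\<^sub>R L"
      using AE by eventually_elim (use KU in \<open>auto simp: indicator_def\<close>)
  qed
  also have "\<dots> = L * (y - x + 2 * r)"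
    using xy(1) r(1) by (simp add: K_def measure_restrict_space)
  finally have right: "\<bar>LINT t:U|lebesgue. g t * \<phi> t\<bar> \<le> L * (y - x + 2 * r)" .
  have "A x - A y = - (LINT t:U|lebesgue. g t * \<phi> t)"
    using weak test left by (simp add: weak_deriv_def)
  then have "\<bar>A x - A y\<bar> \<le> L * (y - x) + 2 * (L * r)"
    using right by (simp add: algebra_simps)
  moreover have "\<bar>A x - v x\<bar> \<le> e / 3" "\<bar>A y - v y\<bar> \<le> e / 3"
    using avg d1(2) d2(2) r(2,3) by (meson order_trans)+
  ultimately show "\<bar>v y - v x\<bar> \<le> L * (y - x) + e"
    using Lr by linarith
qed

subsection \<open>Admissible functions and the maximizer\<close>

text \<open>The set of points of \<open>U\<close> where the functions differ is open and negligible,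
  hence empty; continuity extends the equality to the closure. This transfers boundary values from
  the representative in \<open>W1inf0\<close> to the function itself.\<close>

lemma continuous_AE_eq_on_closure:
  fixes v w :: "real \<Rightarrow> real"
  assumes U: "open U" and v: "continuous_on (closure U) v" and w: "continuous_on (closure U) w"
    and eq: "AE x in lebesgue_on U. w x = v x" and x: "x \<in> closure U"
  shows "w x = v x"
proof -
  have cont: "continuous_on (closure U) (\<lambda>x. w x - v x)"
    by (intro continuous_intros v w)
  then have "continuous_on U (\<lambda>x. w x - v x)"
    using closure_subset by (rule continuous_on_subset)
  then have "open (U \<inter> (\<lambda>x. w x - v x) -` (- {0}))"
    using U by (intro continuous_open_preimage) auto
  moreover have "negligible (U \<inter> (\<lambda>x. w x - v x) -` (- {0}))"
  proof -
    have "AE x in lebesgue. x \<in> U \<longrightarrow> w x = v x"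
      using eq U by (subst (asm) AE_restrict_space_iff) auto
    then have "AE x in lebesgue. x \<notin> U \<inter> (\<lambda>x. w x - v x) -` (- {0})"
      by eventually_elim auto
    then show ?thesis
      by (simp add: negligible_iff_null_sets completion.AE_iff_null_sets AE_iff_null_sets calculation borel_open)
  qed
  ultimately have "U \<inter> (\<lambda>x. w x - v x) -` (- {0}) = {}"
    using open_not_negligible by blast
  then have "\<And>x. x \<in> U \<Longrightarrow> w x - v x = 0"
    by auto
  from continuous_constant_on_closure[OF cont this x] show ?thesis
    by simp
qed

lemma admissible_zero:
  assumes D: "open D" "open E" and v: "v \<in> admissible D E"
    and z: "z \<in> closure (D \<inter> E) \<or> z \<in> frontier (D \<union> E)"
  shows "v z = 0"
proof (cases "z \<in> closure (D \<inter> E)")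
  case False
  then have z: "z \<in> frontier (D \<union> E)"
    using z by simp
  obtain w where "continuous_on (closure (D \<union> E)) w" "AE x in lebesgue_on (D \<union> E). w x = v x" "w z = 0"
    using v z by (auto simp: admissible_def W1inf0_def)
  then show ?thesis
    using continuous_AE_eq_on_closure[of "D \<union> E" v w z] D v z
    by (auto simp: admissible_def frontier_def)
qed (use v in \<open>simp add: admissible_def\<close>)

text \<open>Here \<open>p\<close> and \<open>q\<close> may lie on the frontier, outside the reach of
  the estimate on closed intervals in the open set. Continuity up to the closure supplies the
  limit.\<close>

lemma admissible_lipschitz:
  assumes D: "open D" "open E" and v: "v \<in> admissible D E" and pq: "p \<le> q" "{p<..<q} \<subseteq> D \<union> E"
  shows "\<bar>v q - v p\<bar> \<le> q - p"
proof (cases "p = q")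
  case False
  then have "p < q" using pq by simp
  let ?U = "D \<union> E"
  obtain g where g: "weak_deriv ?U v g" "Linf_norm ?U g \<le> ereal 1"
    using v by (auto simp: admissible_def one_ereal_def)
  have cont: "continuous_on (closure ?U) v"
    using v by (simp add: admissible_def)
  then have contU: "continuous_on ?U v"
    using closure_subset by (rule continuous_on_subset)
  have lip: "\<bar>v t - v s\<bar> \<le> t - s" if "p < s" "s \<le> t" "t < q" for s t
  proof -
    have "{s..t} \<subseteq> {p<..<q}"
      using that by auto
    with pq(2) have "{s..t} \<subseteq> ?U" by blast
    then show ?thesis
      using weak_deriv_bounded_imp_lipschitz[OF open_Un[OF D] g contU, of s t] that by simp
  qed
  have "{p..q} \<subseteq> closure ?U"
    using closure_mono[OF pq(2)] \<open>p < q\<close> by simp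
  then have v_pq: "continuous_on {p..q} v"
    using cont continuous_on_subset by blast
  \<comment> \<open>Splitting at an interior point leaves a single one-sided limit in each
    half.\<close>
  define m where "m = (p + q) / 2"
  have m: "p < m" "m < q"
    using \<open>p < q\<close> by (auto simp: m_def)
  have "((\<lambda>t. \<bar>v t - v m\<bar>) \<longlongrightarrow> \<bar>v q - v m\<bar>) (at_left q)" "((\<lambda>t. t - m) \<longlongrightarrow> q - m) (at_left q)"
    using continuous_on_Icc_at_leftD[OF v_pq \<open>p < q\<close>] by (auto intro!: tendsto_intros)
  then have "\<bar>v q - v m\<bar> \<le> q - m"
    using lip[of m] m by (intro tendsto_le[of "at_left q"]) (auto simp: eventually_at_left_field)
  moreover
  have "((\<lambda>t. \<bar>v m - v t\<bar>) \<longlongrightarrow> \<bar>v m - v p\<bar>) (at_right p)" "((\<lambda>t. m - t) \<longlongrightarrow> m - p) (at_right p)"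
    using continuous_on_Icc_at_rightD[OF v_pq \<open>p < q\<close>] by (auto intro!: tendsto_intros)
  then have "\<bar>v m - v p\<bar> \<le> m - p"
    using lip[of _ m] m by (intro tendsto_le[of "at_right p"]) (auto simp: eventually_at_right_field)
  ultimately show ?thesis by linarith
qed simp

section \<open>Tents, their slopes, and the candidate maximizer\<close>

text \<open>The distance to the complement of \<open>(p, q)\<close>, and zero when
  \<open>q \<le> p\<close>.\<close>

definition tent :: "real \<Rightarrow> real \<Rightarrow> real \<Rightarrow> real" where
  "tent p q x = max 0 (min (x - p) (q - x))"

text \<open>The open half-intervals give the value 0 at the kinks. For reversed endpoints both are
  empty, in accordance with \<open>tent\<close>.\<close>

definition tent_slope :: "real \<Rightarrow> real \<Rightarrow> real \<Rightarrow> real" where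
  "tent_slope p q x = indicator {p<..<(p + q) / 2} x - indicator {(p + q) / 2<..<q} x"

lemma tent_nonneg: "0 \<le> tent p q x"
  by (simp add: tent_def)

lemma tent_continuous: "continuous_on S (tent p q)"
  unfolding tent_def[abs_def] by (intro continuous_intros)

lemma tent_has_deriv:
  assumes "x \<noteq> p" "x \<noteq> q" "x \<noteq> (p + q) / 2"
  shows "(tent p q has_real_derivative tent_slope p q x) (at x)"
proof -
  let ?m = "(p + q) / 2"
  \<comment> \<open>Away from the kinks a tent is affine near \<open>x\<close>. The last of the five
    cases is that of reversed endpoints.\<close>
  have "\<exists>c d A. open A \<and> x \<in> A \<and> (\<forall>y\<in>A. tent p q y = c + d * y) \<and> tent_slope p q x = d"
  proof -
    consider "x < min p q" | "x > max p q" | "p < x" "x < q" "x < ?m" | "p < x" "x < q" "x > ?m"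
      | "q < x" "x < p"
      using assms by linarith
    then show ?thesis
    proof cases
      case 1
      then show ?thesis
        by (intro exI[of _ 0] exI[of _ "{..<min p q}"]) (auto simp: tent_def tent_slope_def)
    next
      case 2
      then show ?thesis
        by (intro exI[of _ 0] exI[of _ "{max p q<..}"]) (auto simp: tent_def tent_slope_def)
    next
      case 3
      then show ?thesis
        by (intro exI[of _ "- p"] exI[of _ 1] exI[of _ "{p<..<?m}"]) (auto simp: tent_def tent_slope_def field_simps)
    next
      case 4
      then show ?thesis
        by (intro exI[of _ q] exI[of _ "-1"] exI[of _ "{?m<..<q}"]) (auto simp: tent_def tent_slope_def field_simps)
    next
      case 5
      then show ?thesis
        by (intro exI[of _ 0] exI[of _ "{q<..<p}"]) (auto simp: tent_def tent_slope_def)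
    qed
  qed
  then obtain c d A where A: "open A" "x \<in> A" "\<And>y. y \<in> A \<Longrightarrow> tent p q y = c + d * y" "tent_slope p q x = d"
    by blast
  have "((\<lambda>y. c + d * y) has_real_derivative d) (at x)"
    by (auto intro!: derivative_eq_intros)
  then show ?thesis
    unfolding A(4) by (rule has_field_derivative_transform_within_open[OF _ A(1,2)]) (use A(3) in auto)
qed

lemma tent_slope_measurable: "tent_slope p q \<in> borel_measurable borel"
  unfolding tent_slope_def[abs_def] by measurable

text \<open>
  The distance to the complement of \<open>(a, b) - [c, d]\<close>. This set consists of the intervals
  \<open>(a, min b c)\<close> and \<open>(max a d, b)\<close>, either of which may be empty, and tents over reversed
  endpoints vanish.
\<close>

definition side :: "real \<Rightarrow> real \<Rightarrow> real \<Rightarrow> real \<Rightarrow> real \<Rightarrow> real" where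
  "side a b c d x = tent a (min b c) x + tent (max a d) b x"

definition side_slope :: "real \<Rightarrow> real \<Rightarrow> real \<Rightarrow> real \<Rightarrow> real \<Rightarrow> real" where
  "side_slope a b c d x = tent_slope a (min b c) x + tent_slope (max a d) b x"

lemma side_nonneg: "0 \<le> side a b c d x"
  by (simp add: side_def tent_nonneg)

lemma side_eq_zero:
  assumes "c < d" "x \<notin> {a<..<b} - {c..d}"
  shows "side a b c d x = 0"
  using assms by (auto simp: side_def tent_def)

lemma tent_slope_eq_zero: "x \<notin> {p<..<q} \<Longrightarrow> tent_slope p q x = 0"
  by (auto simp: tent_slope_def)

lemma tent_slope_bound: "\<bar>tent_slope p q x\<bar> \<le> 1"
  by (simp add: tent_slope_def indicator_def)

lemma side_slope_eq_zero:
  assumes "c < d" "x \<notin> {a<..<b} - {c..d}"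
  shows "side_slope a b c d x = 0"
proof -
  have "tent_slope a (min b c) x = 0" "tent_slope (max a d) b x = 0"
    using assms by (auto intro!: tent_slope_eq_zero)
  then show ?thesis by (simp add: side_slope_def)
qed

text \<open>The two tents lie on opposite sides of \<open>(c, d)\<close>, so at most one slope is
  nonzero at any point.\<close>

lemma side_slope_bound:
  assumes "c < d"
  shows "\<bar>side_slope a b c d x\<bar> \<le> 1"
proof (cases "x < c")
  case True
  then have "tent_slope (max a d) b x = 0"
    using assms by (intro tent_slope_eq_zero) auto
  then show ?thesis
    by (simp add: side_slope_def tent_slope_bound)
next
  case False
  then have "tent_slope a (min b c) x = 0"
    by (intro tent_slope_eq_zero) auto
  then show ?thesis
    by (simp add: side_slope_def tent_slope_bound)
qed

text \<open>The two slopes live on the disjoint sets \<open>(a, b) - [c, d]\<close> and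
  \<open>(c, d) - [a, b]\<close>, so their bounds do not add up.\<close>

lemma side_slope_diff_bound:
  assumes "a < b" "c < d"
  shows "\<bar>side_slope a b c d x - side_slope c d a b x\<bar> \<le> 1"
proof (cases "x \<in> {a<..<b} - {c..d}")
  case True
  then have "side_slope c d a b x = 0"
    using assms(1) by (intro side_slope_eq_zero) auto
  then show ?thesis
    by (simp add: side_slope_bound assms)
next
  case False
  then have "side_slope a b c d x = 0"
    by (intro side_slope_eq_zero assms)
  then show ?thesis
    by (simp add: side_slope_bound assms)
qed

section \<open>Upper bound for admissible functions and admissibility of the candidate\<close>

text \<open>The component of \<open>(a, b) - [c, d]\<close> around \<open>x\<close> ends at two
  zeros of \<open>v\<close>: an endpoint of \<open>D\<close> outside \<open>E\<close> lies on the
  frontier of the union, and an endpoint of \<open>E\<close> inside \<open>D\<close> lies in the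
  closure of the intersection. The Lipschitz bound from both zeros is the tent.\<close>

lemma admissible_abs_le_side:
  assumes D: "D = {a<..<b}" "a < b" and E: "E = {c<..<d}" "c < d"
    and v: "v \<in> admissible D E" and x: "x \<in> {a<..<b} - {c..d}"
  shows "\<bar>v x\<bar> \<le> side a b c d x"
proof -
  have D_E: "open D" "open E"
    by (simp_all add: D E)
  have bound: "\<bar>v x\<bar> \<le> tent p q x"
    if pq: "p < x" "x < q" "{p<..<q} \<subseteq> D \<union> E" and "v p = 0" "v q = 0" for p q
  proof -
    have "{p<..<x} \<subseteq> {p<..<q}" "{x<..<q} \<subseteq> {p<..<q}"
      using pq by auto
    with pq(3) have "{p<..<x} \<subseteq> D \<union> E" "{x<..<q} \<subseteq> D \<union> E"
      by blast+
    then show ?thesis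
      using admissible_lipschitz[OF D_E v, of p x] admissible_lipschitz[OF D_E v, of x q] that
      by (simp add: tent_def)
  qed
  have out: "v z = 0" if "z \<in> closure D" "z \<notin> D" "z \<notin> E" for z
  proof -
    have "z \<in> closure (D \<union> E)"
      using that(1) by simp
    then have "z \<in> frontier (D \<union> E)"
      using that(2,3) interior_open[OF open_Un[OF D_E]] by (simp add: frontier_def)
    then show ?thesis
      by (intro admissible_zero[OF D_E v] disjI2)
  qed
  \<comment> \<open>The strict inequality says that the intersection is nonempty, so that its
    closure is the full closed interval.\<close>
  have inter: "v z = 0" if "max a c < min b d" "z \<in> {max a c..min b d}" for z
  proof -
    have "closure (D \<inter> E) = {max a c..min b d}"
      unfolding D(1) E(1) Int_greaterThanLessThan by (rule closure_greaterThanLessThan[OF that(1)])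
    then show ?thesis
      using that(2) by (intro admissible_zero[OF D_E v] disjI1) simp
  qed
  have ends: "a \<in> closure D" "b \<in> closure D" "a \<notin> D" "b \<notin> D"
    using D by auto
  consider "x < c" | "d < x" using x by force
  then show ?thesis
  proof cases
    case 1
    have "\<bar>v x\<bar> \<le> tent a (min b c) x"
    proof (rule bound)
      show "v a = 0"
        using x 1 by (intro out ends) (simp add: E)
      show "v (min b c) = 0"
      proof (cases "b \<le> c")
        case True
        then have "v b = 0" by (intro out ends) (simp add: E)
        with True show ?thesis by simp
      next
        case False
        then have "v c = 0" using x 1 E(2) by (intro inter) auto
        with False show ?thesis by simp
      qed
      show "{a<..<min b c} \<subseteq> D \<union> E" unfolding D(1) by auto
    qed (use x 1 in auto)
    then show ?thesis
      unfolding side_def using tent_nonneg[of "max a d" b x] by linarith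
  next
    case 2
    have "\<bar>v x\<bar> \<le> tent (max a d) b x"
    proof (rule bound)
      show "v b = 0"
        using x 2 by (intro out ends) (simp add: E)
      show "v (max a d) = 0"
      proof (cases "d \<le> a")
        case True
        then have "v a = 0" by (intro out ends) (simp add: E)
        with True show ?thesis by simp
      next
        case False
        then have "v d = 0" using x 2 E(2) by (intro inter) auto
        with False show ?thesis by simp
      qed
      show "{max a d<..<b} \<subseteq> D \<union> E" unfolding D(1) by auto
    qed (use x 2 in auto)
    then show ?thesis
      unfolding side_def using tent_nonneg[of a "min b c" x] by linarith
  qed
qed

text \<open>The slope bound 1 comes from \<open>side_slope_diff_bound\<close>. The zero conditions
  hold because the function is supported on two sets that miss both the frontier of the union and
  the closure of the intersection.\<close>

lemma side_diff_admissible: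
  assumes D: "D = {a<..<b}" "a < b" and E: "E = {c<..<d}" "c < d"
  shows "(\<lambda>x. side a b c d x - side c d a b x) \<in> admissible D E"
proof -
  let ?U = "D \<union> E"
  define u g where "u x = side a b c d x - side c d a b x"
    and "g x = side_slope a b c d x - side_slope c d a b x" for x
  have U: "open ?U" "bounded ?U"
    by (simp_all add: D E open_Un)
  have cont: "continuous_on S u" for S
    unfolding u_def[abs_def] side_def[abs_def] by (intro continuous_intros tent_continuous)
  have g_le: "\<bar>g x\<bar> \<le> 1" for x
    unfolding g_def by (rule side_slope_diff_bound[OF D(2) E(2)])
  have g_meas: "g \<in> borel_measurable borel"
    unfolding g_def[abs_def] side_slope_def[abs_def]
    by (intro borel_measurable_diff borel_measurable_add tent_slope_measurable)
  \<comment> \<open>The three possible kinks of one tent; \<open>u\<close> is built from four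
    tents.\<close>
  define T where "T = (\<lambda>(p, q). {p, q, (p + q) / 2 :: real})"
  have "weak_deriv ?U u g"
  proof (rule weak_deriv_piecewise[where L = 1])
    let ?S = "T (a, min b c) \<union> T (max a d, b) \<union> T (c, min d a) \<union> T (max c b, d)"
    show "finite ?S" by (simp add: T_def)
    show "(u has_real_derivative g x) (at x)" if "x \<notin> ?S" for x
      unfolding u_def[abs_def] g_def side_def[abs_def] side_slope_def
      using that by (intro DERIV_diff DERIV_add tent_has_deriv) (auto simp: T_def)
    show "g \<in> borel_measurable lebesgue"
      using g_meas by (simp add: measurable_completion)
  qed (use cont g_le in auto)
  moreover have norm: "Linf_norm ?U h \<le> ereal L"
    if "h \<in> borel_measurable (lebesgue_on ?U)" "\<And>x. x \<in> ?U \<Longrightarrow> \<bar>h x\<bar> \<le> L" for h L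
    unfolding Linf_norm_def using that by (intro esssup_I) (auto intro!: AE_I2)
  have g_on: "g \<in> borel_measurable (lebesgue_on ?U)"
    using g_meas by (intro measurable_restrict_space1 measurable_completion) simp
  moreover have "Linf_norm ?U g \<le> ereal 1"
    using g_on g_le by (rule norm)
  moreover have u_on: "u \<in> borel_measurable (lebesgue_on ?U)"
    using U(1) by (intro continuous_imp_measurable_on_sets_lebesgue cont) auto
  moreover have "compact (u ` closure ?U)"
    using U(2) by (intro compact_continuous_image cont) (simp only: compact_closure)
  then obtain L where "\<And>x. x \<in> closure ?U \<Longrightarrow> \<bar>u x\<bar> \<le> L"
    unfolding compact_eq_bounded_closed bounded_iff by auto
  then have "Linf_norm ?U u \<le> ereal L"
    using closure_subset by (intro norm u_on) blast
  ultimately have W: "u \<in> W1inf ?U" and wd: "\<exists>g. weak_deriv ?U u g \<and> Linf_norm ?U g \<le> 1"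
    unfolding W1inf_def Linf_def
    by (auto simp: one_ereal_def intro!: exI[of _ g] elim: order.strict_trans1)
  have zero: "u x = 0" if "x \<notin> {a<..<b} - {c..d}" "x \<notin> {c<..<d} - {a..b}" for x
    using that D E by (simp add: u_def side_eq_zero)
  have "u x = 0" if "x \<in> frontier ?U" for x
    using that U(1) by (intro zero) (auto simp: frontier_def interior_open D E)
  then have "u \<in> W1inf0 ?U"
    unfolding W1inf0_def using W cont by (auto intro!: exI[of _ u])
  moreover have "u x = 0" if "x \<in> closure (D \<inter> E)" for x
  proof -
    have "x \<in> closure D" "x \<in> closure E"
      using that closure_mono[OF Int_lower1, of D E] closure_mono[OF Int_lower2, of D E] by blast+
    then have "x \<in> {a..b}" "x \<in> {c..d}"
      using D E by simp_all
    then show ?thesis by (intro zero) auto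
  qed
  ultimately have "u \<in> admissible D E"
    unfolding admissible_def using cont wd by auto
  then show ?thesis
    by (simp add: u_def[abs_def])
qed

section \<open>Optimality of the candidate\<close>

text \<open>The endpoints are \<open>Inf D\<close> and \<open>Sup D\<close>: openness keeps them out
  of \<open>D\<close>, and connectedness fills the gap between them.\<close>

lemma domain_1d_bounded_interval:
  assumes "domain_1d D" "bounded D"
  obtains a b where "D = {a<..<b}" "a < b"
proof -
  have D: "open D" "connected D" "D \<noteq> {}"
    using assms(1) by (auto simp: domain_1d_def)
  have bdd: "bdd_above D" "bdd_below D"
    using assms(2) by (auto intro: bounded_imp_bdd_above bounded_imp_bdd_below)
  have "Inf D \<notin> D" "Sup D \<notin> D"
    using Inf_notin_open[OF D(1), of "Inf D - 1"] Sup_notin_open[OF D(1), of "Sup D + 1"] bdd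
      cInf_lower[of _ D] cSup_upper[of _ D] by fastforce+
  have "D = {Inf D<..<Sup D}"
  proof (intro equalityI subsetI)
    fix x assume "x \<in> D"
    then have "Inf D \<le> x" "x \<le> Sup D"
      using bdd by (auto intro: cInf_lower cSup_upper)
    then show "x \<in> {Inf D<..<Sup D}"
      using \<open>x \<in> D\<close> \<open>Inf D \<notin> D\<close> \<open>Sup D \<notin> D\<close> by (auto simp: less_le)
  next
    fix x assume x: "x \<in> {Inf D<..<Sup D}"
    then obtain y z where "y \<in> D" "y < x" "z \<in> D" "x < z"
      using D(3) bdd by (auto simp: cInf_less_iff less_cSup_iff)
    then show "x \<in> D"
      using connectedD_interval[OF D(2)] by (meson less_imp_le)
  qed
  moreover from this D(3) have "Inf D < Sup D"
    by (metis greaterThanLessThan_empty_iff not_le)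
  ultimately show ?thesis by (rule that)
qed

theorem theorem1p2:
  fixes D E :: "real set" and fp fm f :: "real \<Rightarrow> real"
  assumes "domain_1d D" and "bounded D"
    and "domain_1d E" and "bounded E"
    and "continuous_on (closure D) fp" and "\<forall>x\<in>D. fp x > 0"
    and "continuous_on (closure E) fm" and "\<forall>x\<in>E. fm x > 0"
    and "(LINT x:D|lebesgue. fp x) = 1" and "(LINT x:E|lebesgue. fm x) = 1"
    and "f = (\<lambda>x. extend_zero (closure D) fp x - extend_zero (closure E) fm x)"
  shows "\<exists>u\<in>admissible D E. \<forall>v\<in>admissible D E.
           kantorovich (D \<union> E) f v \<le> kantorovich (D \<union> E) f u"
proof -
  obtain a b where D: "D = {a<..<b}" "a < b"
    using domain_1d_bounded_interval assms(1,2) by blast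
  obtain c d where E: "E = {c<..<d}" "c < d"
    using domain_1d_bounded_interval assms(3,4) by blast
  let ?U = "D \<union> E"
  define u where "u x = side a b c d x - side c d a b x" for x
  have u: "u \<in> admissible D E"
    using side_diff_admissible[OF D E] by (simp add: u_def[abs_def])
  have le: "v x * f x \<le> u x * f x" "0 \<le> u x * f x" if x: "x \<in> ?U" and v: "v \<in> admissible D E" for v x
  proof -
    consider "x \<in> {a<..<b} - {c..d}" | "x \<in> {c<..<d} - {a..b}"
      | "x \<notin> {a<..<b} - {c..d}" "x \<notin> {c<..<d} - {a..b}" "x \<in> closure (D \<inter> E)"
    proof (cases "x \<in> {a<..<b} - {c..d} \<or> x \<in> {c<..<d} - {a..b}")
      case False
      have "x \<in> D \<and> x \<in> closure E \<or> x \<in> E \<and> x \<in> closure D"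
        using x False D E by auto
      \<comment> \<open>The remaining points lie in one interval and in the closure of the other.
        Openness of the intervals puts them in the closure of the intersection, where every
        admissible function vanishes.\<close>
      moreover have "D \<inter> closure E \<subseteq> closure (D \<inter> E)" "E \<inter> closure D \<subseteq> closure (D \<inter> E)"
        using open_Int_closure_subset[of D E] open_Int_closure_subset[of E D]
        by (auto simp: D E Int_commute)
      ultimately show ?thesis
        using False that(3) by blast
    qed (use that in blast)
    then have "v x * f x \<le> u x * f x \<and> 0 \<le> u x * f x"
    proof cases
      case 1
      then have "f x > 0" "u x = side a b c d x"
        using assms(6) D E by (auto simp: assms(11) extend_zero_def u_def side_eq_zero)
      moreover have "v x \<le> side a b c d x"
        using admissible_abs_le_side[OF D E v 1] by simp
      ultimately show ?thesis
        using side_nonneg[of a b c d x] by (simp add: mult_right_mono)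
    next
      case 2
      then have "f x < 0" "u x = - side c d a b x"
        using assms(8) D E by (auto simp: assms(11) extend_zero_def u_def side_eq_zero)
      \<comment> \<open>Admissibility is symmetric in the two intervals, so the bound applies with
        their roles exchanged.\<close>
      moreover have "v \<in> admissible E D"
        using v by (simp add: admissible_def Un_commute Int_commute)
      then have "- side c d a b x \<le> v x"
        using admissible_abs_le_side[OF E D _ 2] by fastforce
      ultimately show ?thesis
        using side_nonneg[of c d a b x] 
        using mult_right_mono_neg[of "- side c d a b x" "v x" "f x"] by (simp add: mult_nonneg_nonpos)
    next
      case 3
      have "v x = 0" "u x = 0"
        using admissible_zero[OF _ _ v, of x] admissible_zero[OF _ _ u, of x] 3(3) by (auto simp: D E)
      then show ?thesis by simp
    qed
    then show "v x * f x \<le> u x * f x" "0 \<le> u x * f x" by auto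
  qed
  have cont: "continuous_on (closure ?U) u"
    using u by (simp add: admissible_def)
  \<comment> \<open>Since \<open>f\<close> may jump at the endpoints, each density is treated on the
    closed interval where it is continuous.\<close>
  have "set_integrable lebesgue (closure D) (\<lambda>x. u x * fp x)" "set_integrable lebesgue (closure E) (\<lambda>x. u x * fm x)"
    using assms(2,4,5,7)
    by (auto intro!: set_integrable_continuous_compact continuous_intros continuous_on_subset[OF cont])
  then have "integrable lebesgue (\<lambda>x. indicator (closure D) x *\<^sub>R (u x * fp x) - indicator (closure E) x *\<^sub>R (u x * fm x))"
    unfolding set_integrable_def by (rule Bochner_Integration.integrable_diff)
  then have "set_integrable lebesgue ?U (\<lambda>x. indicator (closure D) x *\<^sub>R (u x * fp x) - indicator (closure E) x *\<^sub>R (u x * fm x))"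
    unfolding set_integrable_def
    by (rule integrable_mult_indicator[rotated]) (simp add: D E)
  moreover have "indicator (closure D) x *\<^sub>R (u x * fp x) - indicator (closure E) x *\<^sub>R (u x * fm x) = u x * f x" for x
    by (simp add: assms(11) extend_zero_def indicator_def algebra_simps)
  ultimately have int: "set_integrable lebesgue ?U (\<lambda>x. u x * f x)"
    by simp
  have "kantorovich ?U f v \<le> kantorovich ?U f u" if "v \<in> admissible D E" for v
    unfolding kantorovich_def set_lebesgue_integral_def
  \<comment> \<open>This rule asks for integrability and nonnegativity of the larger integrand only.
    Should the smaller one fail to be integrable, its integral is 0 by convention, and
    \<open>0 \<le> u x * f x\<close> still gives the inequality.\<close>
  proof (rule integral_mono')
    show "integrable lebesgue (\<lambda>x. indicator ?U x *\<^sub>R (u x * f x))"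
      using int by (simp add: set_integrable_def)
  qed (use le that u in \<open>auto simp: indicator_def\<close>)
  with u show ?thesis by blast
qed

end
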